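(* Let $(X,\tau)$ be a locally compact strong $R$-space. Then $\Gamma((X,\tau))\setminus\{\emptyset\}=Q((X,\tau^{d}))$, and hence $\tau=\tau^{dd}$.
   Context: For a $T_0$-space $X$: a subset is saturated if it equals the intersection of all open sets containing it; $\Gamma(X)$ is the set of all closed subsets of $X$; $Q(X)$ is the set of all nonempty compact saturated subsets of $X$ (compactness is the open-cover property). A $T_0$-space $X$ is a strong $R$-space if for every nonempty family $\{K_i: i\in I\}\subseteq Q(X)$ and every open $U\subseteq X$, $\bigcap_{i\in I}K_i\subseteq U$ implies $\bigcap_{i\in J}K_i\subseteq U$ for some nonempty finite $J\subseteq I$. $X$ is locally compact if for every $x\in X$ and open $U\ni x$ there is a compact set $K$ with $x\in\mathrm{int}\,K\subseteq K\subseteq U$. The (de Groot) dual $\tau^{d}$ of a $T_0$-topology $\tau$ is the topology on the same set having all compact saturated sets of $(X,\tau)$ as a basis for its closed sets (so its closed sets are exactly the arbitrary intersections of compact saturated sets of $(X,\tau)$, the empty intersection being the whole set); $\tau^{dd}=(\tau^{d})^{d}$. *)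

theory Defs
  imports "HOL-Analysis.Analysis"
begin

text \<open>A space is an abstract topology \<open>X\<close> with carrier \<open>topspace X\<close>.\<close>

definition saturatedin :: "'a topology \<Rightarrow> 'a set \<Rightarrow> bool" where
  "saturatedin X S \<longleftrightarrow> S \<subseteq> topspace X \<and> S = \<Inter> {U. openin X U \<and> S \<subseteq> U}"

definition closed_sets :: "'a topology \<Rightarrow> 'a set set" where
  "closed_sets X = {C. closedin X C}"

definition nonempty_compact_saturated :: "'a topology \<Rightarrow> 'a set set" where
  "nonempty_compact_saturated X = {K. K \<noteq> {} \<and> compactin X K \<and> saturatedin X K}"

definition strong_R_space :: "'a topology \<Rightarrow> bool" where
  "strong_R_space X \<longleftrightarrow>
     t0_space X \<and>
     (\<forall>\<K> U. \<K> \<noteq> {} \<and> \<K> \<subseteq> nonempty_compact_saturated X \<and> openin X U \<and> \<Inter>\<K> \<subseteq> U \<longrightarrow>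
        (\<exists>\<J>. \<J> \<subseteq> \<K> \<and> \<J> \<noteq> {} \<and> finite \<J> \<and> \<Inter>\<J> \<subseteq> U))"

text \<open>In the absence of the Hausdorff property, the library's \<^const>\<open>locally_compact_space\<close>
  (every point has some compact neighbourhood) is weaker than the following notion, which asks
  for a neighbourhood base of compact sets at every point.\<close>

definition locally_compact_basis_space :: "'a topology \<Rightarrow> bool" where
  "locally_compact_basis_space X \<longleftrightarrow>
     (\<forall>x \<in> topspace X. \<forall>U. openin X U \<and> x \<in> U \<longrightarrow>
        (\<exists>K. compactin X K \<and> x \<in> X interior_of K \<and> K \<subseteq> U))"

text \<open>The closed sets of the de Groot dual are the intersections of families of compact saturated
  sets (see \<open>closedin_de_groot_dual\<close> below). Intersecting with the carrier makes
  the empty intersection equal to the whole space.\<close>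

definition de_groot_dual :: "'a topology \<Rightarrow> 'a topology" where
  "de_groot_dual X =
     topology (\<lambda>U. U \<subseteq> topspace X \<and>
       (\<exists>\<K>. (\<forall>K \<in> \<K>. compactin X K \<and> saturatedin X K) \<and>
            topspace X - U = topspace X \<inter> \<Inter>\<K>))"

lemma saturatedin_Un:
  assumes S: "saturatedin X S" and T: "saturatedin X T"
  shows "saturatedin X (S \<union> T)"
proof -
  have "x \<in> S \<union> T" if x: "x \<in> \<Inter> {U. openin X U \<and> S \<union> T \<subseteq> U}" for x
  proof (rule ccontr)
    assume "x \<notin> S \<union> T"
    then have "x \<notin> \<Inter> {U. openin X U \<and> S \<subseteq> U}" "x \<notin> \<Inter> {U. openin X U \<and> T \<subseteq> U}"
      using S T unfolding saturatedin_def by simp_all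
    then obtain U V where "openin X U" "S \<subseteq> U" "x \<notin> U" "openin X V" "T \<subseteq> V" "x \<notin> V"
      by auto
    then have "openin X (U \<union> V)" "S \<union> T \<subseteq> U \<union> V" "x \<notin> U \<union> V"
      by auto
    with x show False by blast
  qed
  then have "S \<union> T = \<Inter> {U. openin X U \<and> S \<union> T \<subseteq> U}"
    by (intro equalityI subsetI) auto
  moreover have "S \<union> T \<subseteq> topspace X"
    using S T unfolding saturatedin_def by simp
  ultimately show ?thesis
    unfolding saturatedin_def by (rule conjI[rotated])
qed

lemma istopology_de_groot_dual:
  "istopology (\<lambda>U. U \<subseteq> topspace X \<and>
     (\<exists>\<K>. (\<forall>K \<in> \<K>. compactin X K \<and> saturatedin X K) \<and>
          topspace X - U = topspace X \<inter> \<Inter>\<K>))"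
  (is "istopology ?P")
  unfolding istopology_def
proof (intro conjI allI impI)
  fix S T assume S: "?P S" and T: "?P T"
  then show "S \<inter> T \<subseteq> topspace X" by blast
  obtain \<A> where A: "\<forall>K \<in> \<A>. compactin X K \<and> saturatedin X K"
      "topspace X - S = topspace X \<inter> \<Inter>\<A>" using S by blast
  obtain \<B> where B: "\<forall>K \<in> \<B>. compactin X K \<and> saturatedin X K"
      "topspace X - T = topspace X \<inter> \<Inter>\<B>" using T by blast
  let ?C = "{K \<union> L | K L. K \<in> \<A> \<and> L \<in> \<B>}"
  have "\<forall>K \<in> ?C. compactin X K \<and> saturatedin X K"
    using A(1) B(1) by (auto intro: compactin_Un saturatedin_Un)
  moreover have C: "\<Inter>?C = \<Inter>\<A> \<union> \<Inter>\<B>"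
  proof (intro equalityI subsetI)
    fix x assume x: "x \<in> \<Inter>?C"
    show "x \<in> \<Inter>\<A> \<union> \<Inter>\<B>"
    proof (rule ccontr)
      assume "x \<notin> \<Inter>\<A> \<union> \<Inter>\<B>"
      then obtain K L where "K \<in> \<A>" "L \<in> \<B>" "x \<notin> K \<union> L" by auto
      with x show False by blast
    qed
  qed auto
  have "topspace X - S \<inter> T = topspace X \<inter> \<Inter>?C"
    by (simp only: C Diff_Int A(2) B(2) Int_Un_distrib)
  ultimately show "\<exists>\<K>. (\<forall>K \<in> \<K>. compactin X K \<and> saturatedin X K) \<and>
          topspace X - S \<inter> T = topspace X \<inter> \<Inter>\<K>" by blast
next
  fix \<U> assume U: "\<forall>U \<in> \<U>. ?P U"
  then show "\<Union>\<U> \<subseteq> topspace X" by blast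
  from U have "\<forall>U \<in> \<U>. \<exists>\<K>. (\<forall>K \<in> \<K>. compactin X K \<and> saturatedin X K) \<and>
      topspace X - U = topspace X \<inter> \<Inter>\<K>"
    by simp
  from bchoice[OF this] obtain f where
      f: "\<forall>U \<in> \<U>. (\<forall>K \<in> f U. compactin X K \<and> saturatedin X K) \<and>
        topspace X - U = topspace X \<inter> \<Inter>(f U)"
    by (rule exE)
  have "topspace X - \<Union>\<U> = topspace X \<inter> (\<Inter>U\<in>\<U>. topspace X - U)" by auto
  also have "(\<Inter>U\<in>\<U>. topspace X - U) = (\<Inter>U\<in>\<U>. topspace X \<inter> \<Inter>(f U))"
    by (rule INF_cong[OF refl]) (use f in simp)
  also have "topspace X \<inter> \<dots> = topspace X \<inter> \<Inter>(\<Union>(f ` \<U>))" by auto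
  finally show "\<exists>\<K>. (\<forall>K \<in> \<K>. compactin X K \<and> saturatedin X K) \<and>
          topspace X - \<Union>\<U> = topspace X \<inter> \<Inter>\<K>"
    using f by (intro exI[of _ "\<Union>(f ` \<U>)"] conjI) (simp_all only: ball_UN, simp)
qed

lemma openin_de_groot_dual:
  "openin (de_groot_dual X) U \<longleftrightarrow>
     U \<subseteq> topspace X \<and>
     (\<exists>\<K>. (\<forall>K \<in> \<K>. compactin X K \<and> saturatedin X K) \<and>
          topspace X - U = topspace X \<inter> \<Inter>\<K>)"
  unfolding de_groot_dual_def
  by (simp add: topology_inverse'[OF istopology_de_groot_dual])

lemma topspace_de_groot_dual [simp]: "topspace (de_groot_dual X) = topspace X"
proof (rule antisym)
  show "topspace (de_groot_dual X) \<subseteq> topspace X"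
    using openin_topspace[of "de_groot_dual X"] by (simp only: openin_de_groot_dual)
  have "saturatedin X {}"
    unfolding saturatedin_def using openin_empty[of X] by auto
  then have "\<forall>K \<in> {{}}. compactin X K \<and> saturatedin X K"
    by simp
  moreover have "topspace X - topspace X = topspace X \<inter> \<Inter>{{}}"
    by simp
  ultimately have "openin (de_groot_dual X) (topspace X)"
    unfolding openin_de_groot_dual by (intro conjI exI subset_refl)
  then show "topspace X \<subseteq> topspace (de_groot_dual X)"
    by (rule openin_subset)
qed

lemma closedin_de_groot_dual:
  "closedin (de_groot_dual X) C \<longleftrightarrow>
     (\<exists>\<K>. (\<forall>K \<in> \<K>. compactin X K \<and> saturatedin X K) \<and> C = topspace X \<inter> \<Inter>\<K>)"
proof (cases "C \<subseteq> topspace X")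
  case True
  then have "topspace X - (topspace X - C) = C" by (rule double_diff) simp
  with True show ?thesis
    by (simp only: closedin_def openin_de_groot_dual topspace_de_groot_dual Diff_subset simp_thms)
next
  case False
  then show ?thesis
    unfolding closedin_def topspace_de_groot_dual by (metis Int_lower1)
qed

end

theory Submission imports Defs begin

text \<open>The dual reverses the specialization order. A closed set is an intersection of complements of
  principal up-sets, so it is saturated in the dual, and the strong \<open>R\<close> property is exactly
  compactness of closed sets in the dual, read off on complements. Conversely, let \<open>A\<close> be compact
  saturated in the dual and \<open>x \<notin> A\<close>. Every \<open>k \<in> A\<close> is missed by some open neighbourhood of \<open>x\<close>,
  hence by a compact saturated neighbourhood; the complements of these neighbourhoods are open in
  the dual and cover \<open>A\<close>, and intersecting finitely many of the neighbourhoods separates \<open>x\<close>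
  from \<open>A\<close>.\<close>

text \<open>If \<open>S\<close> is not contained in the carrier, no open set qualifies and the value
  is \<open>UNIV\<close>; hence the carrier hypothesis in
  \<open>saturatedin_saturation_of\<close>.\<close>

definition saturation_of :: "'a topology \<Rightarrow> 'a set \<Rightarrow> 'a set" where
  "saturation_of X S = \<Inter> {U. openin X U \<and> S \<subseteq> U}"

lemma saturation_of_superset: "S \<subseteq> saturation_of X S"
  unfolding saturation_of_def by blast

lemma saturation_of_subset_open: "openin X U \<Longrightarrow> S \<subseteq> U \<Longrightarrow> saturation_of X S \<subseteq> U"
  unfolding saturation_of_def by blast

lemma saturatedin_saturation_of:
  assumes "S \<subseteq> topspace X"
  shows "saturatedin X (saturation_of X S)"
proof -
  have "saturation_of X S \<subseteq> topspace X"
    using assms by (intro saturation_of_subset_open) auto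
  moreover have "S \<subseteq> U \<longleftrightarrow> saturation_of X S \<subseteq> U" if "openin X U" for U
    using that saturation_of_superset saturation_of_subset_open by (metis subset_trans)
  then have "{U. openin X U \<and> S \<subseteq> U} = {U. openin X U \<and> saturation_of X S \<subseteq> U}"
    by (intro Collect_cong conj_cong refl)
  then have "saturation_of X S = \<Inter> {U. openin X U \<and> saturation_of X S \<subseteq> U}"
    by (subst saturation_of_def) (rule arg_cong)
  ultimately show ?thesis
    unfolding saturatedin_def by (rule conjI)
qed

text \<open>Any finite subfamily of an open cover that covers \<open>S\<close> has an open union,
  and an open set containing \<open>S\<close> contains its saturation.\<close>

lemma compactin_saturation_of:
  assumes "compactin X S"
  shows "compactin X (saturation_of X S)"
proof -
  have S: "S \<subseteq> topspace X"
    using assms by (rule compactin_subset_topspace)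
  show ?thesis
    unfolding compactin_def
  proof (intro conjI allI impI)
    show "saturation_of X S \<subseteq> topspace X"
      using saturatedin_saturation_of[OF S] unfolding saturatedin_def by (rule conjunct1)
  next
    fix \<U> assume U: "Ball \<U> (openin X) \<and> saturation_of X S \<subseteq> \<Union>\<U>"
    then have "Ball \<U> (openin X)" "S \<subseteq> \<Union>\<U>"
      using saturation_of_superset[of S X] by auto
    then obtain \<F> where F: "finite \<F>" "\<F> \<subseteq> \<U>" "S \<subseteq> \<Union>\<F>"
      using assms unfolding compactin_def by meson
    moreover have "openin X (\<Union>\<F>)"
      using U F by (intro openin_Union) auto
    ultimately show "\<exists>\<F>. finite \<F> \<and> \<F> \<subseteq> \<U> \<and> saturation_of X S \<subseteq> \<Union>\<F>"
      using saturation_of_subset_open by metis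
  qed
qed

lemma openin_de_groot_dual_Diff:
  assumes "compactin X K" "saturatedin X K"
  shows "openin (de_groot_dual X) (topspace X - K)"
  unfolding openin_de_groot_dual
proof (intro conjI exI)
  show "\<forall>L \<in> {K}. compactin X L \<and> saturatedin X L"
    using assms by simp
qed auto

lemma saturatedin_separation:
  assumes "saturatedin X S" "x \<notin> S"
  obtains U where "openin X U" "S \<subseteq> U" "x \<notin> U"
  using assms unfolding saturatedin_def by blast

lemma saturatedinI:
  assumes "S \<subseteq> topspace X"
    and "\<And>x. x \<in> topspace X \<Longrightarrow> x \<notin> S \<Longrightarrow> \<exists>U. openin X U \<and> S \<subseteq> U \<and> x \<notin> U"
  shows "saturatedin X S"
proof -
  have "x \<in> S" if "x \<in> \<Inter> {U. openin X U \<and> S \<subseteq> U}" for x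
    using that assms openin_topspace[of X] by blast
  then have "S = \<Inter> {U. openin X U \<and> S \<subseteq> U}"
    by (intro equalityI subsetI) auto
  with assms(1) show ?thesis
    unfolding saturatedin_def by (rule conjI)
qed

text \<open>For \<open>x\<close> outside \<open>C\<close>, the saturation of \<open>{x}\<close> is
  compact and stays inside the open complement of \<open>C\<close>, so its complement is a dual-open
  set around \<open>C\<close> that misses \<open>x\<close>.\<close>

lemma saturatedin_de_groot_dual_closedin:
  assumes "closedin X C"
  shows "saturatedin (de_groot_dual X) C"
proof (rule saturatedinI)
  show C: "C \<subseteq> topspace (de_groot_dual X)"
    using closedin_subset[OF assms] by simp
  fix x assume "x \<in> topspace (de_groot_dual X)" and x: "x \<notin> C"
  then have top: "x \<in> topspace X" by simp
  let ?K = "saturation_of X {x}"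
  have "openin (de_groot_dual X) (topspace X - ?K)"
    using top by (intro openin_de_groot_dual_Diff compactin_saturation_of saturatedin_saturation_of)
      (auto simp: finite_imp_compactin)
  moreover have "?K \<subseteq> topspace X - C"
    using assms top x by (intro saturation_of_subset_open) auto
  then have "C \<subseteq> topspace X - ?K"
    using C by auto
  ultimately show "\<exists>U. openin (de_groot_dual X) U \<and> C \<subseteq> U \<and> x \<notin> U"
    using saturation_of_superset[of "{x}" X] by blast
qed

lemma compactin_de_groot_dual_closedin:
  assumes R: "strong_R_space X" and C: "closedin X C"
  shows "compactin (de_groot_dual X) C"
  unfolding compactin_def
proof (intro conjI allI impI)
  show sub: "C \<subseteq> topspace (de_groot_dual X)"
    using closedin_subset[OF C] by simp
  fix \<U> assume U: "Ball \<U> (openin (de_groot_dual X)) \<and> C \<subseteq> \<Union>\<U>"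
  \<comment> \<open>The complements of the members of \<open>\<K>\<close> are the basic dual-open
    sets lying inside some member of the cover; by \<open>pick\<close> they still cover
    \<open>C\<close>.\<close>
  define \<K> where "\<K> = {K. compactin X K \<and> saturatedin X K \<and> (\<exists>V\<in>\<U>. topspace X - V \<subseteq> K)}"
  have pick: "\<exists>K\<in>\<K>. x \<notin> K" if x: "x \<in> C" for x
  proof -
    obtain V where V: "V \<in> \<U>" "x \<in> V"
      using U x by blast
    then obtain \<A> where A: "\<forall>K\<in>\<A>. compactin X K \<and> saturatedin X K"
        "topspace X - V = topspace X \<inter> \<Inter>\<A>"
      using U openin_de_groot_dual[of X V] by blast
    have "x \<notin> topspace X \<inter> \<Inter>\<A>"
      using V(2) by (simp flip: A(2))
    then obtain K where "K \<in> \<A>" "x \<notin> K"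
      using x sub by auto
    then show ?thesis
      using A V unfolding \<K>_def by blast
  qed
  have "\<exists>\<J>\<subseteq>\<K>. finite \<J> \<and> C \<inter> \<Inter>\<J> = {}"
  proof -
    \<comment> \<open>\<open>strong_R_space\<close> speaks of nonempty families of nonempty sets, so
      the degenerate cases are split off.\<close>
    consider "C = {}" | "{} \<in> \<K>" | "C \<noteq> {}" "{} \<notin> \<K>"
      by blast
    then show ?thesis
    proof cases
      case 1
      then show ?thesis by blast
    next
      case 2
      then show ?thesis by (intro exI[of _ "{{}}"]) simp
    next
      case 3
      have ne: "\<K> \<noteq> {}"
        using 3(1) pick by blast
      have K: "\<K> \<subseteq> nonempty_compact_saturated X"
        using 3(2) unfolding nonempty_compact_saturated_def \<K>_def by blast
      have "K \<subseteq> topspace X" if "K \<in> \<K>" for K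
        using that unfolding \<K>_def by (simp add: compactin_subset_topspace)
      with ne pick have "\<Inter>\<K> \<subseteq> topspace X - C"
        by blast
      moreover have "openin X (topspace X - C)"
        using C by blast
      ultimately obtain \<J> where "\<J> \<subseteq> \<K>" "finite \<J>" "\<Inter>\<J> \<subseteq> topspace X - C"
        using R ne K unfolding strong_R_space_def by meson
      then show ?thesis by blast
    qed
  qed
  then obtain \<J> where J: "\<J> \<subseteq> \<K>" "finite \<J>" "C \<inter> \<Inter>\<J> = {}"
    by blast
  have "\<forall>K\<in>\<J>. \<exists>V. V \<in> \<U> \<and> topspace X - V \<subseteq> K"
    using J(1) unfolding \<K>_def by blast
  then obtain f where f: "\<forall>K\<in>\<J>. f K \<in> \<U> \<and> topspace X - f K \<subseteq> K"
    by metis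
  \<comment> \<open>A point of \<open>C\<close> lies outside some \<open>K\<close> in
    \<open>\<J>\<close>, hence inside \<open>f K\<close>.\<close>
  have "C \<subseteq> \<Union>(f ` \<J>)"
    using f J(3) sub by fastforce
  then show "\<exists>\<F>. finite \<F> \<and> \<F> \<subseteq> \<U> \<and> C \<subseteq> \<Union>\<F>"
    using f J(2) by (intro exI[of _ "f ` \<J>"]) auto
qed

text \<open>This is the order reversal: a dual-open set containing \<open>k\<close> but not
  \<open>x\<close> yields a compact saturated set containing \<open>x\<close> but not
  \<open>k\<close>, and saturation enlarges that to an open set still missing
  \<open>k\<close>.\<close>

lemma saturatedin_de_groot_dual_separation:
  assumes A: "saturatedin (de_groot_dual X) A" and x: "x \<in> topspace X" "x \<notin> A" and k: "k \<in> A"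
  obtains U where "openin X U" "x \<in> U" "k \<notin> U"
proof -
  obtain V where V: "openin (de_groot_dual X) V" "A \<subseteq> V" "x \<notin> V"
    using saturatedin_separation[OF A x(2)] .
  then obtain \<K> where K: "\<forall>K\<in>\<K>. compactin X K \<and> saturatedin X K"
      "V \<subseteq> topspace X" "topspace X - V = topspace X \<inter> \<Inter>\<K>"
    using openin_de_groot_dual[of X V] by blast
  then obtain S where S: "S \<in> \<K>" "k \<notin> S"
    using k V(2) by blast
  then have "x \<in> S"
    using K(3) V(3) x(1) by blast
  obtain U where "openin X U" "S \<subseteq> U" "k \<notin> U"
    using saturatedin_separation S K(1) by metis
  with \<open>x \<in> S\<close> that show ?thesis by blast
qed

lemma closedin_de_groot_dual_compact_saturated:
  assumes X: "locally_compact_basis_space X"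
    and cpt: "compactin (de_groot_dual X) A" and sat: "saturatedin (de_groot_dual X) A"
  shows "closedin X A"
proof -
  have sub: "A \<subseteq> topspace X"
    using compactin_subset_topspace[OF cpt] by simp
  have "\<exists>T. openin X T \<and> x \<in> T \<and> T \<subseteq> topspace X - A" if x: "x \<in> topspace X - A" for x
  proof -
    define \<L> where "\<L> = {L. compactin X L \<and> saturatedin X L \<and> x \<in> X interior_of L}"
    have cover: "\<exists>L\<in>\<L>. k \<notin> L" if k: "k \<in> A" for k
    proof -
      obtain U where U: "openin X U" "x \<in> U" "k \<notin> U"
        using saturatedin_de_groot_dual_separation[OF sat _ _ k] x by blast
      then obtain L where L: "compactin X L" "x \<in> X interior_of L" "L \<subseteq> U"
        using X x unfolding locally_compact_basis_space_def by blast
      \<comment> \<open>Local compactness need not give a saturated \<open>L\<close>; saturating it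
        keeps \<open>x\<close> in the interior and does not leave the open set
        \<open>U\<close>.\<close>
      have "x \<in> X interior_of saturation_of X L"
        using interior_of_mono[OF saturation_of_superset[of L X]] L(2) by blast
      then have "saturation_of X L \<in> \<L>"
        using L(1) unfolding \<L>_def
        by (simp add: compactin_saturation_of saturatedin_saturation_of compactin_subset_topspace)
      moreover have "k \<notin> saturation_of X L"
        using saturation_of_subset_open[OF U(1) L(3)] U(3) by blast
      ultimately show ?thesis by blast
    qed
    have "\<forall>V \<in> (\<lambda>L. topspace X - L) ` \<L>. openin (de_groot_dual X) V"
      unfolding \<L>_def by (auto intro: openin_de_groot_dual_Diff)
    moreover have "A \<subseteq> \<Union>((\<lambda>L. topspace X - L) ` \<L>)"
      using cover sub by blast
    ultimately obtain \<F> where "finite \<F>" "\<F> \<subseteq> (\<lambda>L. topspace X - L) ` \<L>" "A \<subseteq> \<Union>\<F>"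
      using cpt unfolding compactin_def by meson
    then obtain \<J> where J: "finite \<J>" "\<J> \<subseteq> \<L>" "A \<subseteq> \<Union>((\<lambda>L. topspace X - L) ` \<J>)"
      using finite_subset_image by metis
    \<comment> \<open>The carrier factor covers the case of empty \<open>\<J>\<close>, which forces
      \<open>A\<close> to be empty.\<close>
    define T where "T = topspace X \<inter> \<Inter>((interior_of) X ` \<J>)"
    have "openin X T"
      unfolding T_def using J(1) by (cases "\<J> = {}") (auto intro!: openin_Int openin_Inter)
    moreover have "x \<in> T"
      using x J(2) unfolding T_def \<L>_def by blast
    moreover have "T \<subseteq> topspace X - A"
    proof
      fix y assume y: "y \<in> T"
      then have "y \<in> L" if "L \<in> \<J>" for L
        using that interior_of_subset[of X L] unfolding T_def by blast
      then have "y \<notin> A"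
        using J(3) by blast
      with y show "y \<in> topspace X - A"
        unfolding T_def by blast
    qed
    ultimately show ?thesis by blast
  qed
  then have "openin X (topspace X - A)"
    using openin_subopen by metis
  with sub show ?thesis
    unfolding closedin_def by blast
qed

theorem theorem4p12:
  fixes X :: "'a topology"
  assumes "locally_compact_basis_space X"
    and "strong_R_space X"
  shows "closed_sets X - {{}} = nonempty_compact_saturated (de_groot_dual X)
       \<and> X = de_groot_dual (de_groot_dual X)"
proof
  let ?D = "de_groot_dual X"
  \<comment> \<open>Including the empty set here lets the same equivalence rewrite the generating
    sets of the double dual.\<close>
  have iff: "compactin ?D C \<and> saturatedin ?D C \<longleftrightarrow> closedin X C" for C
    using assms closedin_de_groot_dual_compact_saturated compactin_de_groot_dual_closedin
      saturatedin_de_groot_dual_closedin by metis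
  then show "closed_sets X - {{}} = nonempty_compact_saturated ?D"
    unfolding closed_sets_def nonempty_compact_saturated_def by blast
  have "closedin (de_groot_dual ?D) C \<longleftrightarrow> closedin X C" for C
  proof -
    have "closedin (de_groot_dual ?D) C \<longleftrightarrow>
        (\<exists>\<K>. (\<forall>K\<in>\<K>. closedin X K) \<and> C = topspace X \<inter> \<Inter>\<K>)"
      unfolding closedin_de_groot_dual iff by simp
    also have "\<dots> \<longleftrightarrow> closedin X C"
    proof
      assume "\<exists>\<K>. (\<forall>K\<in>\<K>. closedin X K) \<and> C = topspace X \<inter> \<Inter>\<K>"
      \<comment> \<open>Inserting the carrier makes the family nonempty, as
        \<open>closedin_Inter\<close> requires.\<close>
      then obtain \<K> where "\<forall>K\<in>\<K>. closedin X K" "C = \<Inter>(insert (topspace X) \<K>)"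
        by auto
      then show "closedin X C"
        by (metis closedin_Inter closedin_topspace insert_iff insert_not_empty)
    next
      assume "closedin X C"
      then show "\<exists>\<K>. (\<forall>K\<in>\<K>. closedin X K) \<and> C = topspace X \<inter> \<Inter>\<K>"
        using closedin_subset by (intro exI[of _ "{C}"]) auto
    qed
    finally show ?thesis .
  qed
  then show "X = de_groot_dual ?D"
    by (simp add: topology_eq openin_closedin_eq)
qed

end
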